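(* Let $3\le k<n$, and let $F$, $D=P_1+\dots+P_n$, $P_j=(\alpha_j,\beta_j)$, $\omega$ and $\gamma_j=\mathrm{res}_{P_j}(\omega)$ be as in the context. Then the following orthogonality relations hold. 1. First type: (a) $\sum_{j=1}^{n}\frac{\gamma_j\alpha_j^i}{\beta_j}=0$ for $0\le i\le\lfloor\frac{k}{2}\rfloor+\lfloor\frac{n-k}{2}\rfloor$; (b) $\sum_{j=1}^{n}\gamma_j\alpha_j^i=0$ for $0\le i\le\frac{n}{2}-2$; (c) $\sum_{j=1}^{n}\gamma_j\alpha_j^i\beta_j=0$ for $0\le i\le\lfloor\frac{k-3}{2}\rfloor+\lfloor\frac{n-k-3}{2}\rfloor$. 2. Second type: (a) $\sum_{j=1}^{n}\gamma_j\alpha_j^i=0$ for $0\le i\le\lfloor\frac{k}{2}\rfloor+\lfloor\frac{n-k}{2}\rfloor$; (b) $\sum_{j=1}^{n}\gamma_j\alpha_j^i\beta_j=0$ for $0\le i\le\frac{n}{2}-2$; (c) $\sum_{j=1}^{n}\gamma_j\alpha_j^i\beta_j^2=0$ for $0\le i\le\lfloor\frac{k-3}{2}\rfloor+\lfloor\frac{n-k-3}{2}\rfloor$. 3. Third type: (a) $\sum_{j=1}^{n}\frac{\gamma_j\alpha_j^i}{a\alpha_j+b}=0$ for $0\le i\le\lfloor\frac{k}{2}\rfloor+\lfloor\frac{n-k}{2}\rfloor$; (b) $\sum_{j=1}^{n}\gamma_j\alpha_j^i\beta_j=0$ for $0\le i\le\frac{n}{2}-2$; (c) $\sum_{j=1}^{n}\gamma_j\alpha_j^i(a\alpha_j+b)\beta_j^2=0$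 for $0\le i\le\lfloor\frac{k-3}{2}\rfloor+\lfloor\frac{n-k-3}{2}\rfloor$.
   Context: Elliptic function fields $F=\mathbb{F}_q(x,y)$ of three types: - First type: $q$ odd, $y^2=f(x)$ with $f\in\mathbb{F}_q[x]$ square-free of degree $3$. - Second type: $q$ even, $y^2+y=f(x)$ with $f\in\mathbb{F}_q[x]$, $\deg f=3$. - Third type: $q$ even, $y^2+y=x+\frac{1}{ax+b}$ with $a,b\in\mathbb{F}_q$, $a\ne 0$. Evaluation points: let $T\subseteq\mathbb{F}_q$ be a nonempty set such that for each $\alpha\in T$ the place $x=\alpha$ of $\mathbb{F}_q(x)$ splits completely in $F$, i.e. there are exactly two affine $\mathbb{F}_q$-rational points with $x$-coordinate $\alpha$ (in particular $f(\alpha)\ne0$ for the first type and $a\alpha+b\neq0$ for the third type). The points $P_1,\dots,P_n$, $P_j=(\alpha_j,\beta_j)$, are all these rational points, so $n=2\#T$ is even, and $D=P_1+\cdots+P_n$. Put $t=\prod_{\alpha\in T}(x-\alpha)$ and $\omega=dx/t$; $\gamma_j=\mathrm{res}_{P_j}(\omega)$ is the residue of $\omega$ at $P_j$. *)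

theory Defs
  imports "HOL-Computational_Algebra.Computational_Algebra"
begin

text \<open>
  The finite field \<open>\<F>\<^sub>q\<close> is a type \<open>'a\<close> of sort \<open>{field, finite}\<close>, \<open>q = card (UNIV :: 'a set)\<close>.  A function
  field \<open>F\<close> over it is a subfield, given as a set, of an arbitrary ambient field \<open>'f\<close>; constants
  are embedded by \<open>emb :: 'a \<Rightarrow> 'f\<close>.  (Function fields cannot be types here, since they depend on
  the polynomial that defines them.)
\<close>

subsection \<open>Function fields\<close>

definition field_embedding :: "('a::field \<Rightarrow> 'f::field) \<Rightarrow> bool" where
  "field_embedding emb \<longleftrightarrow>
     emb 1 = 1 \<and> (\<forall>u v. emb (u + v) = emb u + emb v) \<and> (\<forall>u v. emb (u * v) = emb u * emb v)"

definition transcendental_over :: "('a::field \<Rightarrow> 'f::field) \<Rightarrow> 'f \<Rightarrow> bool" where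
  "transcendental_over emb x \<longleftrightarrow> (\<forall>p. p \<noteq> 0 \<longrightarrow> poly (map_poly emb p) x \<noteq> 0)"

definition is_subring :: "'f::field set \<Rightarrow> bool" where
  "is_subring R \<longleftrightarrow> 1 \<in> R \<and> (\<forall>u\<in>R. \<forall>v\<in>R. u - v \<in> R \<and> u * v \<in> R)"

definition is_subfield :: "'f::field set \<Rightarrow> bool" where
  "is_subfield L \<longleftrightarrow> is_subring L \<and> (\<forall>u\<in>L. inverse u \<in> L)"

text \<open>\<open>F = \<F>\<^sub>q(x, y)\<close> with \<open>x\<close> transcendental over \<open>\<F>\<^sub>q\<close>.\<close>

definition generated_function_field ::
    "('a::field \<Rightarrow> 'f::field) \<Rightarrow> 'f \<Rightarrow> 'f \<Rightarrow> 'f set \<Rightarrow> bool" where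
  "generated_function_field emb x y F \<longleftrightarrow>
     field_embedding emb \<and> transcendental_over emb x \<and> F = is_subfield hull (range emb \<union> {x, y})"

subsection \<open>Places, Laurent expansions and residues\<close>

definition valuation_ring :: "('a::field \<Rightarrow> 'f::field) \<Rightarrow> 'f set \<Rightarrow> 'f set \<Rightarrow> bool" where
  "valuation_ring emb F R \<longleftrightarrow>
     is_subring R \<and> range emb \<subset> R \<and> R \<subset> F \<and> (\<forall>z\<in>F. z \<noteq> 0 \<longrightarrow> z \<in> R \<or> inverse z \<in> R)"

text \<open>A place is the maximal ideal, i.e. the set of non-units, of a valuation ring of \<open>F\<close>.\<close>

definition place :: "('a::field \<Rightarrow> 'f::field) \<Rightarrow> 'f set \<Rightarrow> 'f set \<Rightarrow> bool" where
  "place emb F P \<longleftrightarrow>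
     (\<exists>R. valuation_ring emb F R \<and> P = {z \<in> R. z = 0 \<or> inverse z \<notin> R})"

text \<open>The valuation ring is recovered from its maximal ideal \<open>P\<close>.\<close>

definition place_ring :: "'f::field set \<Rightarrow> 'f set \<Rightarrow> 'f set" where
  "place_ring F P = {z \<in> F. z = 0 \<or> inverse z \<notin> P}"

definition local_parameter :: "'f::field set \<Rightarrow> 'f set \<Rightarrow> 'f \<Rightarrow> bool" where
  "local_parameter F P s \<longleftrightarrow> s \<in> F \<and> P = (\<lambda>w. s * w) ` place_ring F P"

text \<open>
  \<open>L\<close> is the \<open>P\<close>-adic expansion of \<open>z\<close> in powers of the local parameter \<open>s\<close>: the partial sums
  of \<open>L\<close> at \<open>s\<close> below \<open>s\<^sup>N\<close> agree with \<open>z\<close> up to an error of order at least \<open>N\<close>.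
\<close>

definition is_expansion ::
    "('a::field \<Rightarrow> 'f::field) \<Rightarrow> 'f set \<Rightarrow> 'f set \<Rightarrow> 'f \<Rightarrow> 'f \<Rightarrow> 'a fls \<Rightarrow> bool" where
  "is_expansion emb F P s z L \<longleftrightarrow>
     (\<forall>N::int. z - (\<Sum>i\<in>{fls_subdegree L..<N}. emb (fls_nth L i) * (s powi i))
                 \<in> (\<lambda>w. (s powi N) * w) ` place_ring F P)"

definition expansion ::
    "('a::field \<Rightarrow> 'f::field) \<Rightarrow> 'f set \<Rightarrow> 'f set \<Rightarrow> 'f \<Rightarrow> 'f \<Rightarrow> 'a fls" where
  "expansion emb F P s z = (THE L. is_expansion emb F P s z L)"

text \<open>
  The residue of the differential \<open>u dv\<close> at a place \<open>P\<close> of degree one: choose a local parameter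
  \<open>s\<close>, expand \<open>u\<close> and \<open>v\<close> as \<open>U(s)\<close> and \<open>V(s)\<close>, and take the coefficient of \<open>s\<^sup>-\<^sup>1\<close> in
  \<open>U(s) V'(s)\<close>, where \<open>u dv = U(s) V'(s) ds\<close>.  It does not depend on the choice of \<open>s\<close>.
\<close>

definition residue ::
    "('a::field \<Rightarrow> 'f::field) \<Rightarrow> 'f set \<Rightarrow> 'f set \<Rightarrow> 'f \<Rightarrow> 'f \<Rightarrow> 'a" where
  "residue emb F P u v =
     (let s = (SOME s. local_parameter F P s)
      in fls_residue (expansion emb F P s u * fls_deriv (expansion emb F P s v)))"

subsection \<open>The three types of elliptic function fields\<close>

definition first_type ::
    "('a::{field,finite} \<Rightarrow> 'f::field) \<Rightarrow> 'f \<Rightarrow> 'f \<Rightarrow> 'f set \<Rightarrow> 'a poly \<Rightarrow> bool" where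
  "first_type emb x y F f \<longleftrightarrow>
     generated_function_field emb x y F \<and> odd (card (UNIV :: 'a set)) \<and> squarefree f \<and> degree f = 3 \<and>
     y ^ 2 = poly (map_poly emb f) x"

definition second_type ::
    "('a::{field,finite} \<Rightarrow> 'f::field) \<Rightarrow> 'f \<Rightarrow> 'f \<Rightarrow> 'f set \<Rightarrow> 'a poly \<Rightarrow> bool" where
  "second_type emb x y F f \<longleftrightarrow>
     generated_function_field emb x y F \<and> even (card (UNIV :: 'a set)) \<and> degree f = 3 \<and>
     y ^ 2 + y = poly (map_poly emb f) x"

definition third_type ::
    "('a::{field,finite} \<Rightarrow> 'f::field) \<Rightarrow> 'f \<Rightarrow> 'f \<Rightarrow> 'f set \<Rightarrow> 'a \<Rightarrow> 'a \<Rightarrow> bool" where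
  "third_type emb x y F a b \<longleftrightarrow>
     generated_function_field emb x y F \<and> even (card (UNIV :: 'a set)) \<and> a \<noteq> 0 \<and>
     y ^ 2 + y = x + 1 / (emb a * x + emb b)"

text \<open>The affine rational points of the three curves.\<close>

definition first_points :: "'a::field poly \<Rightarrow> ('a \<times> 'a) set" where
  "first_points f = {(u, v). v ^ 2 = poly f u}"

definition second_points :: "'a::field poly \<Rightarrow> ('a \<times> 'a) set" where
  "second_points f = {(u, v). v ^ 2 + v = poly f u}"

definition third_points :: "'a::field \<Rightarrow> 'a \<Rightarrow> ('a \<times> 'a) set" where
  "third_points a b = {(u, v). a * u + b \<noteq> 0 \<and> v ^ 2 + v = u + 1 / (a * u + b)}"

subsection \<open>Evaluation points\<close>

text \<open>
  \<open>C\<close> is the set of affine rational points.  Every \<open>u \<in> T\<close> splits completely, the points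
  \<open>(\<alpha> j, \<beta> j)\<close>, \<open>1 \<le> j \<le> n\<close>, enumerate without repetition all points of \<open>C\<close> above \<open>T\<close>, and
  \<open>P j\<close> is the place of \<open>F\<close> at which \<open>x\<close> and \<open>y\<close> take the values \<open>\<alpha> j\<close> and \<open>\<beta> j\<close>.
\<close>

definition evaluation_points ::
    "('a::{field,finite} \<Rightarrow> 'f::field) \<Rightarrow> 'f \<Rightarrow> 'f \<Rightarrow> 'f set \<Rightarrow> ('a \<times> 'a) set \<Rightarrow> 'a set \<Rightarrow> nat \<Rightarrow>
       (nat \<Rightarrow> 'a) \<Rightarrow> (nat \<Rightarrow> 'a) \<Rightarrow> (nat \<Rightarrow> 'f set) \<Rightarrow> bool" where
  "evaluation_points emb x y F C T n \<alpha> \<beta> P \<longleftrightarrow>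
     T \<noteq> {} \<and> (\<forall>u\<in>T. card {v. (u, v) \<in> C} = 2) \<and>
     bij_betw (\<lambda>j. (\<alpha> j, \<beta> j)) {1..n} {(u, v) \<in> C. u \<in> T} \<and>
     (\<forall>j\<in>{1..n}. place emb F (P j) \<and> x - emb (\<alpha> j) \<in> P j \<and> y - emb (\<beta> j) \<in> P j)"

end

(*
  Over a point (alpha, beta) with alpha in T the curve w^2 + c(x) w = g(x) has two distinct
  residues, so x - alpha is a local parameter: A + B w is a unit times a power of x - alpha, because
  after cancelling common factors either it or its conjugate is a unit, and their product is a
  polynomial in x.  If X and W are the expansions of x and s / t in a local parameter s, then
  t * (s / t) = s gives prod (X - u) * W = s, and comparing the coefficients of s yields
  gamma = W_0 X_1 = 1 / t'(alpha).  The two points above alpha are exchanged by conjugation, so each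
  sum becomes a sum over T of p(alpha) / t'(alpha), where p is the trace of the function; this is
  the coefficient of x^(#T - 1) in the Lagrange interpolation of p, hence 0 if deg p <= #T - 2.
*)
theory Submission
  imports Defs
begin

subsection \<open>Places and power series expansions\<close>

text \<open>The definition \<open>residue\<close> picks its local parameter by \<open>SOME\<close>,
  and a place is known only through the memberships of \<open>x - emb \<alpha>\<close> and
  \<open>y - emb \<beta>\<close>. So the computation has to hold for every parameter
  \<open>s\<close>: neither W_0 nor X_1 is determined, only their product. Two facts about the
  abstract place make expansions usable: every element of its ring is a constant modulo
  \<open>P\<close>, and \<open>x - emb \<alpha>\<close> generates \<open>P\<close>. Both follow once
  each nonzero element of \<open>F\<close> is a power of \<open>x - emb \<alpha>\<close> times an
  element with nonzero constant residue. This rests on the difference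
  \<open>2 * b + poly c \<alpha>\<close> of the two residues above \<alpha> being nonzero, a
  condition that excludes ramification in every characteristic. Conjugation acts only on expressions
  A + B w and on values v, never as an automorphism of \<open>F\<close>.\<close>

locale constant_embedding =
  fixes emb :: "'a::field \<Rightarrow> 'f::field"
  assumes field_embedding: "field_embedding emb"
begin

lemma emb_1 [simp]: "emb 1 = 1"
  and emb_add [simp]: "emb (u + v) = emb u + emb v"
  and emb_mult [simp]: "emb (u * v) = emb u * emb v"
  using field_embedding by (auto simp: field_embedding_def)

lemma emb_0 [simp]: "emb 0 = 0"
  using emb_add[of 0 0] by (metis add_cancel_right_left add_0)

lemma emb_minus [simp]: "emb (- u) = - emb u"
  using emb_add[of u "- u"] by (simp add: eq_neg_iff_add_eq_0 add.commute)

lemma emb_diff [simp]: "emb (u - v) = emb u - emb v"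
  using emb_add[of u "- v"] by simp

lemma emb_inverse_cancel: "c \<noteq> 0 \<Longrightarrow> emb c * emb (inverse c) = 1"
  by (simp flip: emb_mult)

lemma emb_eq_0_iff [simp]: "emb c = 0 \<longleftrightarrow> c = 0"
  using emb_inverse_cancel[of c] by (cases "c = 0") auto

lemma emb_inverse: "emb (inverse c) = inverse (emb c)"
  by (cases "c = 0") (auto simp: emb_inverse_cancel intro!: inverse_unique[symmetric])

end

locale function_field_place = constant_embedding emb
  for emb :: "'a::field \<Rightarrow> 'f::field" +
  fixes F P :: "'f set"
  assumes subfield_F: "is_subfield F" and place_P: "place emb F P"
begin

section \<open>Valuation ring and maximal ideal of a place\<close>

abbreviation R :: "'f set" where "R \<equiv> place_ring F P"

text \<open>A nonzero z in \<open>F\<close> lies outside the valuation ring S exactly if its inverse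
  is a non-unit of S, so the ring that \<open>place_ring\<close> rebuilds from \<open>P\<close> is S
  itself.\<close>

lemma valuation_ring_R: "valuation_ring emb F R" and in_P_iff: "z \<in> P \<longleftrightarrow> z \<in> R \<and> (z = 0 \<or> inverse z \<notin> R)"
proof -
  obtain S where S: "valuation_ring emb F S" "P = {z \<in> S. z = 0 \<or> inverse z \<notin> S}"
    using place_P by (auto simp: place_def)
  have "emb 0 \<in> S" using S(1) unfolding valuation_ring_def by blast
  hence "0 \<in> S" by simp
  have "S \<subseteq> F" "\<And>z. z \<in> F \<Longrightarrow> z \<noteq> 0 \<Longrightarrow> z \<in> S \<or> inverse z \<in> S"
    using S(1) by (auto simp: valuation_ring_def)
  hence "z \<in> R \<longleftrightarrow> z \<in> S" for z
    using \<open>0 \<in> S\<close> S(2) by (auto simp: place_ring_def)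
  hence "R = S" by blast
  thus "valuation_ring emb F R" "z \<in> P \<longleftrightarrow> z \<in> R \<and> (z = 0 \<or> inverse z \<notin> R)"
    using S by blast+
qed

lemma R_1 [simp]: "1 \<in> R"
  and R_diff: "u \<in> R \<Longrightarrow> v \<in> R \<Longrightarrow> u - v \<in> R"
  and R_mult: "u \<in> R \<Longrightarrow> v \<in> R \<Longrightarrow> u * v \<in> R"
  and R_subset_F: "R \<subseteq> F"
  and R_emb [simp]: "emb c \<in> R"
  and R_or_inverse: "z \<in> F \<Longrightarrow> z \<noteq> 0 \<Longrightarrow> z \<in> R \<or> inverse z \<in> R"
  and exists_outside_R: "\<exists>z\<in>F. z \<notin> R"
  using valuation_ring_R unfolding valuation_ring_def is_subring_def by blast+

lemma R_0 [simp]: "0 \<in> R"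
  using R_emb[of 0] by simp

lemma R_minus: "u \<in> R \<Longrightarrow> - u \<in> R"
  using R_diff[of 0 u] by simp

lemma R_add: "u \<in> R \<Longrightarrow> v \<in> R \<Longrightarrow> u + v \<in> R"
  using R_diff[of u "- v"] R_minus[of v] by simp

lemma R_power: "u \<in> R \<Longrightarrow> u ^ n \<in> R"
  by (induction n) (auto intro: R_mult)

lemma R_prod: "(\<And>i. i \<in> I \<Longrightarrow> g i \<in> R) \<Longrightarrow> (\<Prod>i\<in>I. g i) \<in> R"
  by (induction I rule: infinite_finite_induct) (auto intro: R_mult)

lemma P_subset_R: "z \<in> P \<Longrightarrow> z \<in> R"
  and P_0 [simp]: "0 \<in> P"
  and one_notin_P [simp]: "1 \<notin> P"
  and inverse_in_R: "z \<in> R \<Longrightarrow> z \<notin> P \<Longrightarrow> inverse z \<in> R"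
  by (auto simp: in_P_iff)

lemma P_mult: assumes "u \<in> P" "v \<in> R" shows "u * v \<in> P"
proof (cases "u * v = 0")
  case False
  have "inverse u \<notin> R" using assms False by (auto simp: in_P_iff)
  moreover have "inverse u = inverse (u * v) * v" using False by (simp add: field_simps)
  ultimately have "inverse (u * v) \<notin> R" using R_mult assms by metis
  thus ?thesis using assms by (auto simp: in_P_iff intro: R_mult)
qed auto

lemma P_mult': "v \<in> R \<Longrightarrow> u \<in> P \<Longrightarrow> v * u \<in> P"
  using P_mult[of u v] by (simp add: mult.commute)

lemma P_minus: "u \<in> P \<Longrightarrow> - u \<in> P"
  using P_mult[of u "- 1"] by (simp add: R_minus)

text \<open>The valuation property puts v / u or u / v into the ring; in the first case u + v = u (1
  + v / u) is a multiple of u, and the other case is symmetric.\<close>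

lemma P_add: assumes "u \<in> P" "v \<in> P" shows "u + v \<in> P"
proof -
  have *: "u + v \<in> P" if u: "u \<in> P" and v: "v \<in> P" and "u \<noteq> 0" and "v / u \<in> R" for u v
  proof -
    have "u * (1 + v / u) \<in> P" using that by (intro P_mult R_add) auto
    moreover have "u * (1 + v / u) = u + v" using \<open>u \<noteq> 0\<close> by (simp add: distrib_left)
    ultimately show ?thesis by simp
  qed
  show ?thesis
  proof (cases "u = 0 \<or> v = 0")
    case False
    have "is_subring F" "\<And>z. z \<in> F \<Longrightarrow> inverse z \<in> F"
      using subfield_F by (auto simp: is_subfield_def)
    moreover have "u \<in> F" "v \<in> F" using assms P_subset_R R_subset_F by auto
    ultimately have "v * inverse u \<in> F" by (auto simp: is_subring_def)
    hence "v / u \<in> R \<or> u / v \<in> R"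
      using R_or_inverse[of "v / u"] False by (auto simp: divide_inverse mult.commute)
    thus ?thesis using * assms False by (metis add.commute)
  qed (use assms in auto)
qed

lemma P_diff: "u \<in> P \<Longrightarrow> v \<in> P \<Longrightarrow> u - v \<in> P"
  using P_add[of u "- v"] P_minus[of v] by simp

lemma emb_in_P_iff [simp]: "emb c \<in> P \<longleftrightarrow> c = 0"
  by (auto simp: in_P_iff simp flip: emb_inverse)

end

text \<open>\<open>residue_constant\<close> expresses that the place has degree one; it is what
  allows the coefficients of expansions to be taken in \<open>'a\<close>.\<close>

locale rational_place_parameter = function_field_place emb F P
  for emb :: "'a::field \<Rightarrow> 'f::field" and F P :: "'f set" +
  fixes s :: 'f
  assumes local_parameter_s: "local_parameter F P s"
    and residue_constant: "z \<in> R \<Longrightarrow> \<exists>c. z - emb c \<in> P"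
begin

lemma in_P_iff_multiple: "u \<in> P \<longleftrightarrow> (\<exists>w\<in>R. u = s * w)"
  using local_parameter_s unfolding local_parameter_def by blast

lemma s_in_P: "s \<in> P"
  using in_P_iff_multiple R_1 by (metis mult_1_right)

lemma s_in_R: "s \<in> R"
  using s_in_P P_subset_R by blast

lemma s_nonzero: "s \<noteq> 0"
proof
  \<comment> \<open>\<open>P\<close> would be trivial and the valuation ring all of
    \<open>F\<close>, against the strict inclusion in \<open>valuation_ring\<close>.\<close>
  assume "s = 0"
  hence P_trivial: "u = 0" if "u \<in> P" for u using that in_P_iff_multiple by auto
  obtain z where z: "z \<in> F" "z \<notin> R" using exists_outside_R by blast
  hence "z \<noteq> 0" by auto
  with z have "inverse z \<in> P" using R_or_inverse by (auto simp: in_P_iff)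
  thus False using P_trivial \<open>z \<noteq> 0\<close> by fastforce
qed

section \<open>Filtration by the order at the place\<close>

definition order_ge :: "int \<Rightarrow> 'f set" where
  "order_ge N = (\<lambda>w. (s powi N) * w) ` R"

text \<open>Turns order bounds into membership in \<open>R\<close>, so that the filtration inherits
  its closure properties from the ring.\<close>

lemma order_ge_iff: "z \<in> order_ge N \<longleftrightarrow> z * s powi (- N) \<in> R"
proof -
  have *: "s powi N * (w * s powi (- N)) = w" for w
    using s_nonzero by (simp add: power_int_minus)
  show ?thesis
  proof
    assume "z \<in> order_ge N"
    then obtain w where "w \<in> R" "z = s powi N * w" by (auto simp: order_ge_def)
    thus "z * s powi (- N) \<in> R" by (simp only: mult.assoc *)
  next
    assume "z * s powi (- N) \<in> R"
    thus "z \<in> order_ge N" unfolding order_ge_def by (intro image_eqI) (auto simp: *)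
  qed
qed

lemma order_ge_add: "u \<in> order_ge N \<Longrightarrow> v \<in> order_ge N \<Longrightarrow> u + v \<in> order_ge N"
  by (simp add: order_ge_iff distrib_right R_add)

lemma order_ge_diff: "u \<in> order_ge N \<Longrightarrow> v \<in> order_ge N \<Longrightarrow> u - v \<in> order_ge N"
  by (simp add: order_ge_iff left_diff_distrib R_diff)

lemma order_ge_emb_mult: "u \<in> order_ge N \<Longrightarrow> emb c * u \<in> order_ge N"
  by (simp add: order_ge_iff mult.assoc R_mult)

lemma order_ge_0: "z \<in> order_ge 0 \<longleftrightarrow> z \<in> R"
  by (simp add: order_ge_iff)

lemma order_ge_shift: "z * s powi m \<in> order_ge (N + m) \<longleftrightarrow> z \<in> order_ge N"
proof -
  have "s powi m * s powi (- (N + m)) = s powi (- N)"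
    using s_nonzero by (simp flip: power_int_add)
  thus ?thesis by (simp add: order_ge_iff mult.assoc)
qed

lemma order_ge_mono: "z \<in> order_ge N \<Longrightarrow> M \<le> N \<Longrightarrow> z \<in> order_ge M"
proof -
  assume z: "z \<in> order_ge N" and "M \<le> N"
  obtain n where n: "N = M + int n" using \<open>M \<le> N\<close> zle_iff_zadd by blast
  have "s powi (- M) = s powi (- N) * s ^ n"
    using s_nonzero power_int_add[of s "- N" "int n"] by (simp add: n)
  thus ?thesis using R_mult[of "z * s powi (- N)" "s ^ n"] z R_power[OF s_in_R]
    by (simp add: order_ge_iff mult.assoc)
qed

abbreviation has_expansion :: "'f \<Rightarrow> 'a fls \<Rightarrow> bool" where
  "has_expansion z L \<equiv> is_expansion emb F P s z L"

text \<open>Coefficients below the subdegree vanish, so the sum may start at any smaller index; two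
  series can then be compared over one range.\<close>

lemma has_expansion_iff:
  assumes "m \<le> fls_subdegree L"
  shows "has_expansion z L \<longleftrightarrow>
    (\<forall>N. z - (\<Sum>i\<in>{m..<N}. emb (fls_nth L i) * s powi i) \<in> order_ge N)"
proof -
  have "(\<Sum>i\<in>{m..<N}. emb (fls_nth L i) * s powi i) =
      (\<Sum>i\<in>{fls_subdegree L..<N}. emb (fls_nth L i) * s powi i)" for N
    using assms by (intro sum.mono_neutral_right) (auto simp: not_le)
  thus ?thesis by (simp add: is_expansion_def order_ge_def)
qed

text \<open>The lowest term of \<open>L - M\<close> would have an order above its own exponent,
  which would put a nonzero constant into \<open>P\<close>. This is the uniqueness behind the
  \<open>THE\<close> in \<open>expansion\<close>.\<close>

lemma has_expansion_unique:
  assumes "has_expansion z L" "has_expansion z M" shows "L = M"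
proof (rule ccontr)
  assume "L \<noteq> M"
  define K where "K = L - M"
  define m where "m = min (fls_subdegree L) (min (fls_subdegree M) (fls_subdegree K))"
  define N where "N = fls_subdegree K"
  have "K \<noteq> 0" using \<open>L \<noteq> M\<close> by (simp add: K_def)
  have "m \<le> fls_subdegree L" "m \<le> fls_subdegree M" by (auto simp: m_def)
  hence "z - (\<Sum>i\<in>{m..<N+1}. emb (fls_nth L i) * s powi i) \<in> order_ge (N + 1)"
    "z - (\<Sum>i\<in>{m..<N+1}. emb (fls_nth M i) * s powi i) \<in> order_ge (N + 1)"
    using assms has_expansion_iff by blast+
  hence "(z - (\<Sum>i\<in>{m..<N+1}. emb (fls_nth M i) * s powi i)) -
      (z - (\<Sum>i\<in>{m..<N+1}. emb (fls_nth L i) * s powi i)) \<in> order_ge (N + 1)"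
    using order_ge_diff by blast
  also have "(z - (\<Sum>i\<in>{m..<N+1}. emb (fls_nth M i) * s powi i)) -
      (z - (\<Sum>i\<in>{m..<N+1}. emb (fls_nth L i) * s powi i)) =
      (\<Sum>i\<in>{m..<N+1}. emb (fls_nth K i) * s powi i)"
    by (simp add: K_def algebra_simps flip: sum_subtractf)
  also have "\<dots> = (\<Sum>i\<in>{N}. emb (fls_nth K i) * s powi i)"
    by (intro sum.mono_neutral_right) (auto simp: N_def m_def not_le not_less)
  finally have "emb (fls_nth K N) * s powi N \<in> order_ge (1 + N)" by (simp add: add.commute)
  hence "emb (fls_nth K N) \<in> order_ge 1" by (simp only: order_ge_shift)
  hence "emb (fls_nth K N) \<in> P" by (auto simp: in_P_iff_multiple order_ge_def)
  thus False using \<open>K \<noteq> 0\<close> by (simp add: N_def)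
qed

lemma expansion_eqI: "has_expansion z L \<Longrightarrow> expansion emb F P s z = L"
  unfolding expansion_def using has_expansion_unique by blast

text \<open>Natural exponents starting at 0 make products accessible to induction; Laurent series
  enter only at the end, by a shift. The instance N = 0 says that z lies in
  \<open>R\<close>.\<close>

definition has_power_series :: "'f \<Rightarrow> 'a fps \<Rightarrow> bool" where
  "has_power_series z A \<longleftrightarrow>
     (\<forall>N::nat. z - (\<Sum>i<N. emb (fps_nth A i) * s ^ i) \<in> order_ge (int N))"

lemma has_expansion_shift:
  assumes "has_power_series z A"
  shows "has_expansion (z * s powi m) (fls_shift (- m) (fps_to_fls A))"
proof -
  let ?L = "fls_shift (- m) (fps_to_fls A)"
  \<comment> \<open>The subdegree exceeds m when low coefficients of a nonzero \<open>A\<close>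
    vanish, and it is 0 for \<open>A = 0\<close>, so neither index bounds the other in
    general.\<close>
  define m0 where "m0 = min m (fls_subdegree ?L)"
  have zero: "fls_nth ?L i = 0" if "i < m" for i using that by simp
  have "z * s powi m - (\<Sum>i\<in>{m..<N}. emb (fls_nth ?L i) * s powi i) \<in> order_ge N" for N
  proof (cases "m \<le> N")
    case True
    have term_eq: "emb (fls_nth ?L i) * s powi i =
        emb (fps_nth A (nat (i - m))) * s ^ nat (i - m) * s powi m" if "m \<le> i" for i
    proof -
      have "s powi i = s ^ nat (i - m) * s powi m"
        using s_nonzero that power_int_add[of s "i - m" m] by (simp add: power_int_def)
      thus ?thesis using that by simp
    qed
    have "(\<Sum>i\<in>{m..<N}. emb (fls_nth ?L i) * s powi i) =
        (\<Sum>i<nat (N - m). emb (fps_nth A i) * s ^ i) * s powi m"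
      unfolding sum_distrib_right using True s_nonzero
      by (intro sum.reindex_bij_witness[of _ "\<lambda>i. int i + m" "\<lambda>i. nat (i - m)"])
        (auto simp: term_eq simp del: fls_shift_nth fps_to_fls_nth)
    moreover have "(z - (\<Sum>i<nat (N - m). emb (fps_nth A i) * s ^ i)) * s powi m
        \<in> order_ge (int (nat (N - m)) + m)"
      using assms by (simp only: order_ge_shift has_power_series_def)
    ultimately show ?thesis using True by (simp add: left_diff_distrib)
  next
    \<comment> \<open>The sum is empty, and z times the m-th power of \<open>s\<close> has order at
      least m, which is above N.\<close>
    case False
    have "z \<in> order_ge 0" using assms by (auto simp: has_power_series_def dest: spec[of _ 0])
    hence "z * s powi m \<in> order_ge (0 + m)" by (simp only: order_ge_shift)
    thus ?thesis using False by (auto intro: order_ge_mono)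
  qed
  moreover have "(\<Sum>i\<in>{m0..<N}. emb (fls_nth ?L i) * s powi i) =
      (\<Sum>i\<in>{m..<N}. emb (fls_nth ?L i) * s powi i)" for N
    by (intro sum.mono_neutral_right) (auto simp: m0_def not_le)
  ultimately show ?thesis
    using has_expansion_iff[of m0 ?L] by (simp add: m0_def)
qed


section \<open>Arithmetic and existence of power series expansions\<close>

lemma has_power_series_in_R: "has_power_series z A \<Longrightarrow> z \<in> R"
  by (auto simp: has_power_series_def order_ge_0 dest: spec[of _ 0])

lemma order_ge_mult_s_iff: "s * z \<in> order_ge (int (Suc N)) \<longleftrightarrow> z \<in> order_ge (int N)"
  using order_ge_shift[of z 1 "int N"] by (simp add: mult.commute add.commute)

text \<open>Once the constant term is removed, the error at precision N + 1 is \<open>s\<close>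
  times the error of the tail at precision N.\<close>

lemma has_power_series_step:
  "has_power_series (emb (fps_nth A 0) + s * z) A \<longleftrightarrow> has_power_series z (fps_shift 1 A)"
proof -
  have *: "emb (fps_nth A 0) + s * z - (\<Sum>i<Suc N. emb (fps_nth A i) * s ^ i) =
      s * (z - (\<Sum>i<N. emb (fps_nth (fps_shift 1 A) i) * s ^ i))" for N
    unfolding sum.lessThan_Suc_shift by (simp add: algebra_simps sum_distrib_left)
  have "emb (fps_nth A 0) + s * z \<in> R" if "z \<in> R"
    using that s_in_R by (intro R_add R_mult) auto
  hence "has_power_series (emb (fps_nth A 0) + s * z) A"
    if "has_power_series z (fps_shift 1 A)"
    unfolding has_power_series_def
  proof (intro allI)
    fix N
    show "emb (fps_nth A 0) + s * z - (\<Sum>i<N. emb (fps_nth A i) * s ^ i) \<in> order_ge (int N)"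
      using \<open>z \<in> R \<Longrightarrow> _\<close> that has_power_series_in_R[OF that]
      by (cases N) (simp_all only: * order_ge_mult_s_iff has_power_series_def
          lessThan_0 sum.empty diff_zero order_ge_0 of_nat_0)
  qed
  moreover have "has_power_series z (fps_shift 1 A)"
    if "has_power_series (emb (fps_nth A 0) + s * z) A"
    using that unfolding has_power_series_def by (metis * order_ge_mult_s_iff)
  ultimately show ?thesis by blast
qed

lemma has_power_series_decompose:
  assumes "has_power_series z A"
  obtains z' where "z = emb (fps_nth A 0) + s * z'" "has_power_series z' (fps_shift 1 A)"
proof -
  have "z = emb (fps_nth A 0) + s * ((z - emb (fps_nth A 0)) / s)"
    using s_nonzero by simp
  thus thesis using that assms has_power_series_step by metis
qed

lemma has_power_series_diff:
  assumes "has_power_series u A" "has_power_series v B"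
  shows "has_power_series (u - v) (A - B)"
  unfolding has_power_series_def
proof
  fix N
  have "u - (\<Sum>i<N. emb (fps_nth A i) * s ^ i) - (v - (\<Sum>i<N. emb (fps_nth B i) * s ^ i))
      \<in> order_ge (int N)"
    using assms order_ge_diff unfolding has_power_series_def by blast
  thus "u - v - (\<Sum>i<N. emb (fps_nth (A - B) i) * s ^ i) \<in> order_ge (int N)"
    by (simp add: algebra_simps sum_subtractf)
qed

lemma has_power_series_const: "has_power_series (emb c) (fps_const c)"
  unfolding has_power_series_def
proof
  fix N :: nat
  show "emb c - (\<Sum>i<N. emb (fps_nth (fps_const c) i) * s ^ i) \<in> order_ge (int N)"
  proof (cases N)
    case (Suc M)
    hence "(\<Sum>i<N. emb (fps_nth (fps_const c) i) * s ^ i) = emb c"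
      by (simp add: sum.lessThan_Suc_shift del: sum.lessThan_Suc)
    thus ?thesis by (simp add: order_ge_iff)
  qed (simp add: order_ge_0)
qed

lemma has_power_series_s: "has_power_series s fps_X"
proof -
  have "fps_shift 1 (fps_X :: 'a fps) = fps_const 1"
    by (auto simp: fps_eq_iff)
  thus ?thesis
    using has_power_series_step[of fps_X 1] has_power_series_const[of 1] by simp
qed

text \<open>Induction on the precision, consuming one coefficient of the first factor at a time:
  with u = a + s u' the product is a v + s (u' v), and A B is a B + X (A' B). This avoids
  rearranging a double sum.\<close>

lemma has_power_series_mult:
  assumes "has_power_series u A" "has_power_series v B"
  shows "has_power_series (u * v) (A * B)"
proof -
  have "u * v - (\<Sum>i<N. emb (fps_nth (A * B) i) * s ^ i) \<in> order_ge (int N)" for N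
    using assms
  proof (induction N arbitrary: u A)
    case 0
    thus ?case by (auto simp: order_ge_0 dest!: has_power_series_in_R intro: R_mult)
  next
    case (Suc N)
    obtain u' where u: "u = emb (fps_nth A 0) + s * u'"
      and u': "has_power_series u' (fps_shift 1 A)"
      using has_power_series_decompose Suc.prems(1) by blast
    define A' C where "A' = fps_shift 1 A" and "C = A' * B"
    have "A = fps_const (fps_nth A 0) + fps_X * A'"
      by (auto simp: fps_eq_iff A'_def)
    hence AB: "A * B = fps_const (fps_nth A 0) * B + fps_X * C"
      by (metis C_def distrib_right mult.assoc)
    have "(\<Sum>i<Suc N. emb (fps_nth (A * B) i) * s ^ i) =
        emb (fps_nth A 0) * (\<Sum>i<Suc N. emb (fps_nth B i) * s ^ i) +
        (\<Sum>i<Suc N. emb (fps_nth (fps_X * C) i) * s ^ i)"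
      unfolding AB by (simp add: ring_distribs sum.distrib sum_distrib_left mult.assoc
          del: sum.lessThan_Suc)
    also have "(\<Sum>i<Suc N. emb (fps_nth (fps_X * C) i) * s ^ i) =
        s * (\<Sum>i<N. emb (fps_nth C i) * s ^ i)"
      unfolding sum.lessThan_Suc_shift sum_distrib_left by (simp add: mult.left_commute)
    finally have "u * v - (\<Sum>i<Suc N. emb (fps_nth (A * B) i) * s ^ i) =
        emb (fps_nth A 0) * (v - (\<Sum>i<Suc N. emb (fps_nth B i) * s ^ i)) +
        s * (u' * v - (\<Sum>i<N. emb (fps_nth C i) * s ^ i))"
      by (simp add: u algebra_simps del: sum.lessThan_Suc)
    moreover have "v - (\<Sum>i<Suc N. emb (fps_nth B i) * s ^ i) \<in> order_ge (int (Suc N))"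
      using Suc.prems(2) unfolding has_power_series_def by blast
    moreover have "u' * v - (\<Sum>i<N. emb (fps_nth C i) * s ^ i) \<in> order_ge (int N)"
      using Suc.IH[OF u' Suc.prems(2)] by (simp only: A'_def C_def)
    ultimately show ?case
      by (simp only: order_ge_add order_ge_emb_mult order_ge_mult_s_iff)
  qed
  thus ?thesis by (simp add: has_power_series_def)
qed

lemma has_power_series_prod:
  "(\<And>i. i \<in> I \<Longrightarrow> has_power_series (g i) (A i)) \<Longrightarrow>
    has_power_series (\<Prod>i\<in>I. g i) (\<Prod>i\<in>I. A i)"
proof (induction I rule: infinite_finite_induct)
  case (insert i I)
  thus ?case by (auto intro: has_power_series_mult)
qed (use has_power_series_const[of 1] in auto)

lemma has_power_series_unique:
  assumes "has_power_series z A" "has_power_series z B" shows "A = B"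
  using has_expansion_unique[of z "fps_to_fls A" "fps_to_fls B"]
    has_expansion_shift[OF assms(1), of 0] has_expansion_shift[OF assms(2), of 0] by simp

lemma ex_power_series:
  assumes "z \<in> R" obtains A where "has_power_series z A"
proof -
  have "\<exists>c w. w \<in> R \<and> z = emb c + s * w" if z: "z \<in> R" for z
  proof -
    obtain c where "z - emb c \<in> P" using residue_constant[OF z] by blast
    then obtain w where "w \<in> R" "z - emb c = s * w" using in_P_iff_multiple by blast
    thus ?thesis by (intro exI[of _ c] exI[of _ w]) (simp add: algebra_simps)
  qed
  then obtain c w where cw: "\<And>z. z \<in> R \<Longrightarrow> w z \<in> R \<and> z = emb (c z) + s * w z"
    by metis
  \<comment> \<open>Iterating the remainder map produces the coefficients; z minus its first N terms
    is exactly \<open>zz N\<close> times the N-th power of \<open>s\<close>.\<close>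
  define zz where "zz n = (w ^^ n) z" for n
  have zz: "zz n \<in> R" "zz n = emb (c (zz n)) + s * zz (Suc n)" for n
  proof -
    show *: "zz n \<in> R" for n using cw assms by (induction n) (auto simp: zz_def)
    show "zz n = emb (c (zz n)) + s * zz (Suc n)" using cw[OF *[of n]] by (simp add: zz_def)
  qed
  have "z - (\<Sum>i<N. emb (c (zz i)) * s ^ i) = zz N * s powi int N" for N
  proof (induction N)
    case (Suc N)
    have "z - (\<Sum>i<Suc N. emb (c (zz i)) * s ^ i) =
        zz N * s ^ N - emb (c (zz N)) * s ^ N" using Suc by simp
    also have "\<dots> = zz (Suc N) * s ^ Suc N" by (subst zz(2)[of N]) (simp add: algebra_simps)
    finally show ?case by (simp only: power_int_of_nat)
  qed (simp add: zz_def)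
  moreover have "zz N * s powi int N \<in> order_ge (0 + int N)" for N
    unfolding order_ge_shift order_ge_0 by (rule zz)
  ultimately have "has_power_series z (Abs_fps (\<lambda>i. c (zz i)))"
    by (simp add: has_power_series_def)
  thus thesis by (rule that)
qed


text \<open>The pole of 1 / t is visible in terms of \<open>x\<close>, while the expansion uses an
  arbitrary \<open>s\<close>. The link is r = s / (x - \<alpha>), which lies in \<open>R\<close>
  because \<open>x - emb \<alpha>\<close> generates \<open>P\<close>.\<close>

lemma residue_simple_pole:
  assumes "finite T" "\<alpha> \<in> T" and parameter: "local_parameter F P (x - emb \<alpha>)"
    and t: "t = (\<Prod>u\<in>T. x - emb u)"
  shows "fls_residue (expansion emb F P s (1 / t) * fls_deriv (expansion emb F P s x)) =
    inverse (\<Prod>u\<in>T - {\<alpha>}. \<alpha> - u)"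
proof -
  interpret x: rational_place_parameter emb F P "x - emb \<alpha>"
    using parameter residue_constant by unfold_locales
  have "x = (x - emb \<alpha>) + emb \<alpha>" by simp
  hence "x \<in> R" using R_add[OF x.s_in_R R_emb[of \<alpha>]] by simp
  then obtain X where X: "has_power_series x X" by (rule ex_power_series)
  obtain x' where x': "x = emb (fps_nth X 0) + s * x'" "has_power_series x' (fps_shift 1 X)"
    using has_power_series_decompose[OF X] .
  \<comment> \<open>This difference of elements of \<open>P\<close> is a constant, hence 0, which
    fixes the constant term of \<open>X\<close>.\<close>
  have "s * x' - (x - emb \<alpha>) \<in> P"
    by (intro P_diff P_mult s_in_P x.s_in_P has_power_series_in_R[OF x'(2)])
  also have "s * x' - (x - emb \<alpha>) = emb (\<alpha> - fps_nth X 0)" by (subst x'(1)) simp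
  finally have X0: "fps_nth X 0 = \<alpha>" by (simp del: emb_diff)
  obtain r where r: "r \<in> R" "s = (x - emb \<alpha>) * r"
    using s_in_P x.in_P_iff_multiple by blast
  define q where "q = (\<Prod>u\<in>T - {\<alpha>}. x - emb u)"
  \<comment> \<open>x - u differs from x - \<alpha> by a nonzero constant, so it is a unit; hence s
    / t = r / q lies in \<open>R\<close>.\<close>
  have unit: "x - emb u \<noteq> 0" "inverse (x - emb u) \<in> R" if "u \<noteq> \<alpha>" for u
  proof -
    have "x - emb u \<notin> P"
    proof
      assume "x - emb u \<in> P"
      hence "(x - emb u) - (x - emb \<alpha>) \<in> P" using P_diff x.s_in_P by blast
      hence "emb (\<alpha> - u) \<in> P" by simp
      thus False using that by (simp del: emb_diff)
    qed
    thus "x - emb u \<noteq> 0" "inverse (x - emb u) \<in> R"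
      using P_0 R_diff[OF \<open>x \<in> R\<close> R_emb[of u]] inverse_in_R by fastforce+
  qed
  have "inverse q = (\<Prod>u\<in>T - {\<alpha>}. inverse (x - emb u))"
    by (simp add: q_def flip: prod_inversef)
  hence "inverse q \<in> R" using unit by (auto intro!: R_prod)
  hence "r * inverse q \<in> R" using r by (intro R_mult)
  then obtain W where W: "has_power_series (r * inverse q) W" by (rule ex_power_series)
  have "q \<noteq> 0" using unit \<open>finite T\<close> by (auto simp: q_def)
  have t_eq: "t = (x - emb \<alpha>) * q"
    unfolding t q_def using assms(1,2) by (rule prod.remove)
  have tw: "t * (r * inverse q) = s"
    using \<open>q \<noteq> 0\<close> by (simp add: t_eq r(2))
  define Q where "Q = (\<Prod>u\<in>T - {\<alpha>}. X - fps_const u)"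
  have "has_power_series (t * (r * inverse q)) ((X - fps_const \<alpha>) * Q * W)"
    unfolding t_eq q_def Q_def
    by (intro has_power_series_mult has_power_series_prod has_power_series_diff
        has_power_series_const X W[unfolded q_def])
  hence "(X - fps_const \<alpha>) * Q * W = fps_X"
    using has_power_series_s has_power_series_unique unfolding tw by blast
  \<comment> \<open>X - \<alpha> has no constant term, so the coefficient of degree 1 involves only
    X_1 and the constant terms of \<open>Q\<close> and \<open>W\<close>.\<close>
  hence "fps_nth ((X - fps_const \<alpha>) * (Q * W)) 1 = 1" by (simp add: mult.assoc)
  hence "fps_nth X 1 * (fps_nth Q 0 * fps_nth W 0) = 1"
    by (simp add: fps_mult_nth X0)
  moreover have "fps_nth Q 0 = (\<Prod>u\<in>T - {\<alpha>}. \<alpha> - u)"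
    unfolding Q_def using \<open>finite T\<close> by (induction T rule: finite_induct)
      (auto simp: X0 insert_Diff_if)
  ultimately have coeff: "fps_nth W 0 * fps_nth X 1 = inverse (\<Prod>u\<in>T - {\<alpha>}. \<alpha> - u)"
    by (intro inverse_unique[symmetric]) (simp add: mult_ac)
  have "1 / t = r * inverse q * s powi (- 1)"
    using tw s_nonzero by (auto simp: field_simps power_int_minus)
  hence "expansion emb F P s (1 / t) = fls_shift 1 (fps_to_fls W)"
    using has_expansion_shift[OF W, of "- 1"] by (auto intro: expansion_eqI)
  moreover have "expansion emb F P s x = fps_to_fls X"
    using has_expansion_shift[OF X, of 0] by (auto intro: expansion_eqI)
  \<comment> \<open>The product is W X' divided by the series variable, so its residue is the
    constant term of W X', that is W_0 X_1.\<close>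
  ultimately show ?thesis
    using coeff
    by (simp add: fls_deriv_fps_to_fls fls_shifted_times_simps flip: fls_times_fps_to_fls)
qed

end

subsection \<open>Places of quadratic extensions of the rational function field\<close>

context constant_embedding
begin

definition poly_at :: "'f \<Rightarrow> 'a poly \<Rightarrow> 'f" where
  "poly_at x p = poly (map_poly emb p) x"

lemma poly_at_0 [simp]: "poly_at x 0 = 0"
  by (simp add: poly_at_def)

lemma poly_at_pCons [simp]: "poly_at x (pCons a p) = emb a + x * poly_at x p"
  by (simp add: poly_at_def map_poly_pCons)

lemma poly_at_1 [simp]: "poly_at x 1 = 1"
  by (simp add: one_pCons)

lemma poly_at_add [simp]: "poly_at x (p + q) = poly_at x p + poly_at x q"
proof -
  have "map_poly emb (p + q) = map_poly emb p + map_poly emb q"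
    by (intro poly_eqI) (simp add: coeff_map_poly)
  thus ?thesis by (simp add: poly_at_def)
qed

lemma poly_at_smult [simp]: "poly_at x (smult a p) = emb a * poly_at x p"
proof -
  have "map_poly emb (smult a p) = smult (emb a) (map_poly emb p)"
    by (intro poly_eqI) (simp add: coeff_map_poly)
  thus ?thesis by (simp add: poly_at_def)
qed

lemma poly_at_minus [simp]: "poly_at x (- p) = - poly_at x p"
  using poly_at_smult[of x "- 1" p] by simp

lemma poly_at_diff [simp]: "poly_at x (p - q) = poly_at x p - poly_at x q"
  using poly_at_add[of x p "- q"] by simp

lemma poly_at_mult [simp]: "poly_at x (p * q) = poly_at x p * poly_at x q"
  by (induction p) (auto simp: algebra_simps)

end

lemma is_subfield_hull: "is_subfield (is_subfield hull S)"
  by (rule hull_in) (unfold is_subfield_def is_subring_def, blast)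

text \<open>
  The multiple \<open>w = D(x) y\<close> clears the denominator in the equation of the third type; \<open>D = 1\<close> otherwise.
\<close>

locale quadratic_place = function_field_place emb F P
  for emb :: "'a::field \<Rightarrow> 'f::field" and F P :: "'f set" +
  fixes x y w :: 'f and D c g :: "'a poly" and \<alpha> b :: 'a
  assumes transcendental_x: "transcendental_over emb x"
    and F_eq: "F = is_subfield hull (range emb \<union> {x, y})"
    and D_nonzero: "D \<noteq> 0"
    and w_eq: "w = poly_at x D * y"
    and quadratic: "w ^ 2 + poly_at x c * w = poly_at x g"
    and x_residue: "x - emb \<alpha> \<in> P"
    and w_residue: "w - emb b \<in> P"
    and distinct_residues: "2 * b + poly c \<alpha> \<noteq> 0"
begin

section \<open>Elements of the function field as fractions in x and w\<close>

abbreviation ev :: "'a poly \<Rightarrow> 'f" where "ev \<equiv> poly_at x"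

lemma ev_eq_0_iff [simp]: "ev p = 0 \<longleftrightarrow> p = 0"
  using transcendental_x by (auto simp: transcendental_over_def poly_at_def)

lemma x_in_R: "x \<in> R"
  using R_add[OF P_subset_R[OF x_residue] R_emb[of \<alpha>]] by simp

lemma ev_in_R: "ev p \<in> R"
  by (induction p) (auto intro!: R_add R_mult x_in_R)

lemma ev_residue: "ev p - emb (poly p \<alpha>) \<in> P"
proof -
  have "[:- \<alpha>, 1:] dvd p - [:poly p \<alpha>:]"
    by (simp flip: poly_eq_0_iff_dvd)
  then obtain q where "p - [:poly p \<alpha>:] = [:- \<alpha>, 1:] * q" by blast
  hence "ev (p - [:poly p \<alpha>:]) = ev ([:- \<alpha>, 1:] * q)" by simp
  hence "ev p - emb (poly p \<alpha>) = (x - emb \<alpha>) * ev q" by (simp add: algebra_simps)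
  thus ?thesis using P_mult[OF x_residue ev_in_R] by simp
qed

lemma parameter_nonzero: "x - emb \<alpha> \<noteq> 0"
  using ev_eq_0_iff[of "[:- \<alpha>, 1:]"] by simp

text \<open>\<open>F\<close> is at most quadratic over the rational functions in x: the fractions (A
  + B w) / C form a subfield containing all generators, so they exhaust the hull.\<close>

lemma F_subset_fractions:
  assumes "z \<in> F"
  shows "\<exists>A B C. C \<noteq> 0 \<and> z * ev C = ev A + ev B * w"
proof -
  define L where "L = {z. \<exists>A B C. C \<noteq> 0 \<and> z * ev C = ev A + ev B * w}"
  have ww: "w * w = ev g - ev c * w"
    using quadratic by (simp add: power2_eq_square algebra_simps)
  have "is_subfield L"
    unfolding is_subfield_def is_subring_def
  proof (intro conjI ballI)
    show "1 \<in> L"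
      unfolding L_def by (intro CollectI exI[of _ 1] exI[of _ 0]) auto
  next
    fix u v assume "u \<in> L" "v \<in> L"
    then obtain A B C A' B' C' where
      u: "C \<noteq> 0" "u * ev C = ev A + ev B * w" and
      v: "C' \<noteq> 0" "v * ev C' = ev A' + ev B' * w"
      unfolding L_def by blast
    have CC': "C * C' \<noteq> 0" using u(1) v(1) by simp
    have "(u - v) * ev (C * C') = (u * ev C) * ev C' - (v * ev C') * ev C"
      by (simp add: algebra_simps)
    also have "\<dots> = ev (A * C' - A' * C) + ev (B * C' - B' * C) * w"
      unfolding u v by (simp add: algebra_simps)
    finally show "u - v \<in> L" using CC' unfolding L_def by blast
    have "(u * v) * ev (C * C') = (u * ev C) * (v * ev C')"
      by (simp add: algebra_simps)
    also have "\<dots> = ev A * ev A' + (ev A * ev B' + ev B * ev A') * w + ev B * ev B' * (w * w)"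
      unfolding u v by (simp add: algebra_simps)
    also have "\<dots> = ev (A * A' + B * B' * g) + ev (A * B' + B * A' - B * B' * c) * w"
      unfolding ww by (simp add: algebra_simps)
    finally show "u * v \<in> L" using CC' unfolding L_def by blast
  next
    fix u assume "u \<in> L"
    then obtain A B C where u: "C \<noteq> 0" "u * ev C = ev A + ev B * w"
      unfolding L_def by blast
    \<comment> \<open>The norm: A + B w times its conjugate A + B (- c - w).\<close>
    define N where "N = A * A - A * B * c - B * B * g"
    have norm: "(ev A + ev B * w) * (ev (A - B * c) - ev B * w) = ev N"
    proof -
      have "(ev A + ev B * w) * (ev (A - B * c) - ev B * w) =
          ev A * ev A - ev A * ev B * ev c - ev B * ev B * (ev c * w + w * w)"
        by (simp add: algebra_simps)
      thus ?thesis unfolding ww by (simp add: N_def algebra_simps)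
    qed
    show "inverse u \<in> L"
    proof (cases "u = 0")
      case True
      thus ?thesis using \<open>u \<in> L\<close> by simp
    next
      case False
      show ?thesis
      proof (cases "N = 0")
        case False
        have "inverse u * ev N = inverse u * (u * ev C) * (ev (A - B * c) - ev B * w)"
          using norm by (simp add: u(2) mult.assoc)
        also have "inverse u * (u * ev C) = ev C" using \<open>u \<noteq> 0\<close> by simp
        also have "ev C * (ev (A - B * c) - ev B * w) = ev (C * (A - B * c)) + ev (- C * B) * w"
          by (simp add: algebra_simps)
        finally show ?thesis using False unfolding L_def by blast
      next
        \<comment> \<open>The quadratic equation may be reducible. Then a vanishing norm forces the
          conjugate to vanish, and A + B w equals a polynomial in x.\<close>
        case True
        have nz: "ev A + ev B * w \<noteq> 0" using u \<open>u \<noteq> 0\<close> by (metis ev_eq_0_iff mult_eq_0_iff)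
        hence "ev B * w = ev (A - B * c)" using norm True by auto
        hence eq: "ev A + ev B * w = ev (A + (A - B * c))"
          by (simp only: poly_at_add)
        have "inverse u * ev (A + (A - B * c)) = inverse u * (u * ev C)"
          by (simp only: u(2) eq)
        hence "inverse u * ev (A + (A - B * c)) = ev C + ev 0 * w"
          using \<open>u \<noteq> 0\<close> by simp
        moreover have "A + (A - B * c) \<noteq> 0" using nz eq by (metis ev_eq_0_iff)
        ultimately show ?thesis unfolding L_def by blast
      qed
    qed
  qed
  moreover have "emb a \<in> L" for a
    unfolding L_def by (intro CollectI exI[of _ 1] exI[of _ 0] exI[of _ "[:a:]"]) simp
  moreover have "x \<in> L"
    unfolding L_def by (intro CollectI exI[of _ 1] exI[of _ 0] exI[of _ "[:0, 1:]"]) simp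
  moreover have "y \<in> L"
    unfolding L_def
    by (intro CollectI exI[of _ 0] exI[of _ 1] exI[of _ D]) (simp add: D_nonzero w_eq mult.commute)
  ultimately have "F \<subseteq> L" unfolding F_eq by (intro hull_minimal) auto
  thus ?thesis using assms unfolding L_def by blast
qed

text \<open>Recording a constant residue \<open>d\<close> of the unit, not merely that it is a unit,
  lets one induction yield both the degree-one property and the local parameter.\<close>

definition has_order :: "'f \<Rightarrow> bool" where
  "has_order z \<longleftrightarrow> (\<exists>m d u. d \<noteq> 0 \<and> u - emb d \<in> P \<and> z = (x - emb \<alpha>) powi m * u)"

lemma has_order_unit: "d \<noteq> 0 \<Longrightarrow> u - emb d \<in> P \<Longrightarrow> has_order u"
  unfolding has_order_def by (intro exI[of _ 0] exI[of _ d] exI[of _ u]) auto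

lemma residue_in_R: "u - emb d \<in> P \<Longrightarrow> u \<in> R"
  using R_add[OF P_subset_R R_emb[of d], of "u - emb d"] by simp

lemma residue_mult:
  assumes "u - emb d \<in> P" "v - emb e \<in> P" shows "u * v - emb (d * e) \<in> P"
proof -
  have "u * v - emb (d * e) = u * (v - emb e) + (u - emb d) * emb e"
    by (simp add: algebra_simps)
  moreover have "u * (v - emb e) + (u - emb d) * emb e \<in> P"
    using assms residue_in_R[OF assms(1)] by (intro P_add P_mult P_mult' R_emb)
  ultimately show ?thesis by (simp only:)
qed

lemma unit_notin_P:
  assumes "d \<noteq> 0" "u - emb d \<in> P" shows "u \<notin> P"
proof
  assume "u \<in> P"
  hence "u - (u - emb d) \<in> P" using assms P_diff by blast
  thus False using assms by simp
qed

lemma residue_inverse: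
  assumes "d \<noteq> 0" "u - emb d \<in> P" shows "inverse u - emb (inverse d) \<in> P"
proof -
  have u: "u \<notin> P" "u \<noteq> 0" using unit_notin_P[OF assms] by auto
  hence "inverse u \<in> R" using residue_in_R[OF assms(2)] inverse_in_R by blast
  moreover have "inverse u - emb (inverse d) = (u - emb d) * (- inverse u * emb (inverse d))"
    using u assms emb_inverse_cancel[of d] by (simp add: field_simps del: emb_eq_0_iff)
  ultimately show ?thesis using assms by (auto intro!: P_minus P_mult R_mult)
qed

lemma has_order_mult: assumes "has_order u" "has_order v" shows "has_order (u * v)"
proof -
  obtain m d u' n e v' where
    "d \<noteq> 0" "u' - emb d \<in> P" "u = (x - emb \<alpha>) powi m * u'"
    "e \<noteq> 0" "v' - emb e \<in> P" "v = (x - emb \<alpha>) powi n * v'"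
    using assms unfolding has_order_def by blast
  thus ?thesis
    unfolding has_order_def using parameter_nonzero
    by (intro exI[of _ "m + n"] exI[of _ "d * e"] exI[of _ "u' * v'"] conjI residue_mult)
      (auto simp: power_int_add)
qed

lemma has_order_inverse: assumes "has_order u" shows "has_order (inverse u)"
proof -
  obtain m d u' where
    "d \<noteq> 0" "u' - emb d \<in> P" "u = (x - emb \<alpha>) powi m * u'"
    using assms unfolding has_order_def by blast
  thus ?thesis
    unfolding has_order_def
    by (intro exI[of _ "- m"] exI[of _ "inverse d"] exI[of _ "inverse u'"] conjI residue_inverse)
      (auto simp: power_int_minus)
qed

lemma has_order_parameter: "has_order (x - emb \<alpha>)"
  unfolding has_order_def by (intro exI[of _ 1] exI[of _ 1]) auto

text \<open>Factors x - \<alpha> are split off until the value at \<alpha> is nonzero; that value is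
  then the residue of the unit.\<close>

lemma has_order_ev: assumes "p \<noteq> 0" shows "has_order (ev p)"
  using assms
proof (induction "degree p" arbitrary: p rule: less_induct)
  case less
  show ?case
  proof (cases "poly p \<alpha> = 0")
    case True
    then obtain q where q: "p = [:- \<alpha>, 1:] * q" by (auto simp: poly_eq_0_iff_dvd)
    with less.prems have "q \<noteq> 0" by auto
    hence "degree q < degree p" unfolding q by (subst degree_mult_eq) auto
    hence "has_order (ev q)" using less \<open>q \<noteq> 0\<close> by blast
    hence "has_order ((x - emb \<alpha>) * ev q)" using has_order_parameter has_order_mult by blast
    also have "(x - emb \<alpha>) * ev q = ev p" by (simp add: q algebra_simps)
    finally show ?thesis .
  qed (use has_order_unit ev_residue in blast)
qed

lemma has_order_linear:
  assumes "ev A + ev B * w \<noteq> 0" shows "has_order (ev A + ev B * w)"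
  using assms
proof (induction "degree A + degree B" arbitrary: A B rule: less_induct)
  case less
  \<comment> \<open>\<open>w'\<close> is the conjugate of \<open>w\<close> and \<open>b'\<close> its residue.\<close>
  define w' where "w' = - ev c - w"
  define b' where "b' = - poly c \<alpha> - b"
  have "- (ev c - emb (poly c \<alpha>)) - (w - emb b) \<in> P"
    by (intro P_diff P_minus ev_residue w_residue)
  hence w'_residue: "w' - emb b' \<in> P" by (simp add: w'_def b'_def algebra_simps)
  have residue: "ev A + ev B * v - emb (poly A \<alpha> + poly B \<alpha> * d) \<in> P"
    if "v - emb d \<in> P" for v d
  proof -
    have "(ev A - emb (poly A \<alpha>)) + (ev B * v - emb (poly B \<alpha> * d)) \<in> P"
      by (intro P_add residue_mult ev_residue that)
    thus ?thesis by (simp add: algebra_simps)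
  qed
  consider "poly A \<alpha> + poly B \<alpha> * b \<noteq> 0" | "poly A \<alpha> + poly B \<alpha> * b' \<noteq> 0"
    | "poly A \<alpha> + poly B \<alpha> * b = 0" "poly A \<alpha> + poly B \<alpha> * b' = 0" by blast
  thus ?case
  proof cases
    case 1
    thus ?thesis using has_order_unit residue[OF w_residue] by blast
  next
    case 2
    \<comment> \<open>The conjugate is a unit here, so A + B w is the norm, a polynomial in x,
      divided by a unit.\<close>
    let ?v = "ev A + ev B * w'"
    have v: "has_order ?v" "?v \<noteq> 0"
      using has_order_unit unit_notin_P residue[OF w'_residue] 2 P_0 by metis+
    define N where "N = A * A - A * B * c - B * B * g"
    have "w * w' = - ev g"
      using quadratic by (simp add: w'_def power2_eq_square algebra_simps)
    moreover have "(ev A + ev B * w) * ?v =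
        ev A * ev A + ev A * ev B * (w + w') + ev B * ev B * (w * w')"
      by (simp add: algebra_simps)
    ultimately have
      "(ev A + ev B * w) * ?v = ev A * ev A + ev A * ev B * (w + w') - ev B * ev B * ev g"
      by simp
    hence norm: "(ev A + ev B * w) * ?v = ev N" by (simp add: N_def w'_def algebra_simps)
    hence "N \<noteq> 0" using less.prems v(2) by (metis ev_eq_0_iff mult_eq_0_iff)
    hence "has_order (ev N * inverse ?v)"
      using v has_order_ev has_order_inverse has_order_mult by blast
    also have "ev N * inverse ?v = ev A + ev B * w"
      using v(2) by (simp flip: norm)
    finally show ?thesis .
  next
    case 3
    \<comment> \<open>Subtracting the two equations leaves B(\<alpha>) times b - b', which is
      nonzero; so \<alpha> is a root of both A and B.\<close>
    hence "poly B \<alpha> * (2 * b + poly c \<alpha>) = 0" by (simp add: b'_def algebra_simps)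
    hence "poly B \<alpha> = 0" using distinct_residues by simp
    moreover from this have "poly A \<alpha> = 0" using 3 by simp
    ultimately obtain A' B' where A': "A = [:- \<alpha>, 1:] * A'" and B': "B = [:- \<alpha>, 1:] * B'"
      unfolding poly_eq_0_iff_dvd by (auto elim!: dvdE)
    have eq: "ev A + ev B * w = (x - emb \<alpha>) * (ev A' + ev B' * w)"
      by (simp add: A' B' algebra_simps)
    \<comment> \<open>A zero polynomial keeps degree 0 under the cancellation, so the measure drops
      only because \<open>A'\<close> or \<open>B'\<close> is nonzero.\<close>
    have deg: "degree ([:- \<alpha>, 1:] * p) = (if p = 0 then 0 else Suc (degree p))" for p :: "'a poly"
      by (auto simp: degree_mult_eq simp del: mult_pCons_left)
    have "A' \<noteq> 0 \<or> B' \<noteq> 0" using less.prems eq by auto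
    hence "degree A' + degree B' < degree A + degree B" unfolding A' B' deg by auto
    moreover have "ev A' + ev B' * w \<noteq> 0" using less.prems eq by auto
    ultimately have "has_order (ev A' + ev B' * w)" by (rule less.hyps)
    thus ?thesis unfolding eq using has_order_mult has_order_parameter by blast
  qed
qed

lemma has_order_F: assumes "z \<in> F" "z \<noteq> 0" shows "has_order z"
proof -
  obtain A B C where *: "C \<noteq> 0" "z * ev C = ev A + ev B * w"
    using F_subset_fractions[OF assms(1)] by blast
  hence "ev A + ev B * w \<noteq> 0" using assms by (simp flip: *(2))
  hence "has_order (z * ev C)" using has_order_linear[of A B] *(2) by simp
  hence "has_order (z * ev C * inverse (ev C))"
    using has_order_ev[OF *(1)] has_order_inverse has_order_mult by blast
  thus ?thesis using *(1) by (simp add: mult.assoc)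
qed

lemma residue_exists:
  assumes "z \<in> R" shows "\<exists>d. z - emb d \<in> P"
proof (cases "z \<in> P")
  case True
  thus ?thesis by (intro exI[of _ 0]) simp
next
  case False
  hence "z \<noteq> 0" by auto
  hence "has_order z" using assms R_subset_F has_order_F by blast
  then obtain m d u where z: "d \<noteq> 0" "u - emb d \<in> P" "z = (x - emb \<alpha>) powi m * u"
    unfolding has_order_def by blast
  have u: "u \<in> R" "inverse u \<in> R" "u \<noteq> 0"
    using unit_notin_P[OF z(1,2)] residue_in_R[OF z(2)] inverse_in_R by auto
  have positive: "(x - emb \<alpha>) powi n \<in> P" if "n > 0" for n
  proof -
    obtain k where "n = int (Suc k)" using \<open>n > 0\<close> by (metis gr0_implies_Suc zero_less_imp_eq_int)
    thus ?thesis
      using P_mult[OF x_residue R_power[of "x - emb \<alpha>" k]] P_subset_R[OF x_residue]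
      by (simp add: power_int_def nat_add_distrib)
  qed
  \<comment> \<open>A unit carries no power of the parameter: m > 0 would put z into
    \<open>P\<close>, and m < 0 its inverse.\<close>
  have "m = 0"
  proof (rule ccontr)
    assume "m \<noteq> 0"
    hence "m > 0 \<or> - m > 0" by auto
    thus False
    proof
      assume "m > 0"
      hence "z \<in> P" unfolding z(3) using u(1) positive P_mult by blast
      thus False using False by simp
    next
      assume "- m > 0"
      hence "(x - emb \<alpha>) powi (- m) * inverse u \<in> P" using positive u(2) P_mult by blast
      hence "inverse z \<in> P" by (simp add: z(3) power_int_minus)
      hence "inverse z * z \<in> P" using assms P_mult by blast
      thus False using \<open>z \<noteq> 0\<close> by simp
    qed
  qed
  thus ?thesis using z by auto
qed

text \<open>For nonzero z in \<open>P\<close> the exponent is positive, since otherwise some ring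
  multiple of z would be 1; one factor x - \<alpha> can therefore be extracted.\<close>

lemma local_parameter_x: "local_parameter F P (x - emb \<alpha>)"
proof -
  have "z \<in> (\<lambda>r. (x - emb \<alpha>) * r) ` R" if "z \<in> P" for z
  proof (cases "z = 0")
    case False
    hence "has_order z" using that P_subset_R R_subset_F has_order_F by blast
    then obtain m d u where z: "d \<noteq> 0" "u - emb d \<in> P" "z = (x - emb \<alpha>) powi m * u"
      unfolding has_order_def by blast
    have u: "u \<in> R" "inverse u \<in> R" "u \<noteq> 0"
      using unit_notin_P[OF z(1,2)] residue_in_R[OF z(2)] inverse_in_R by auto
    have "m > 0"
    proof (rule ccontr)
      assume "\<not> m > 0"
      then obtain k where k: "m = - int k" by (metis nonpos_int_cases not_less)
      have "z * ((x - emb \<alpha>) ^ k * inverse u) \<in> P"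
        using that u(2) R_power[OF P_subset_R[OF x_residue]] by (intro P_mult R_mult)
      moreover have "z * ((x - emb \<alpha>) ^ k * inverse u) = 1"
        using parameter_nonzero u(3) by (simp add: z(3) k power_int_minus field_simps)
      ultimately show False by simp
    qed
    then obtain k where "m = int (Suc k)" by (metis gr0_implies_Suc zero_less_imp_eq_int)
    hence "z = (x - emb \<alpha>) * ((x - emb \<alpha>) ^ k * u)"
      by (simp add: z(3) power_int_def nat_add_distrib)
    thus ?thesis using R_mult R_power u(1) P_subset_R[OF x_residue] by blast
  qed (use R_0 in force)
  hence "P = (\<lambda>r. (x - emb \<alpha>) * r) ` R"
    using P_mult[OF x_residue] by blast
  thus ?thesis
    unfolding local_parameter_def using x_residue P_subset_R R_subset_F by blast
qed

text \<open>\<open>local_parameter_x\<close> supplies the witness for the \<open>SOME\<close> in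
  \<open>residue\<close>, and \<open>residue_exists\<close> the degree-one hypothesis, so whichever
  parameter is chosen is covered.\<close>

lemma residue_eq:
  assumes "finite T" "\<alpha> \<in> T" "t = (\<Prod>u\<in>T. x - emb u)"
  shows "residue emb F P (1 / t) x = inverse (\<Prod>u\<in>T - {\<alpha>}. \<alpha> - u)"
proof -
  define s where "s = (SOME s. local_parameter F P s)"
  have "local_parameter F P s"
    unfolding s_def using local_parameter_x by (rule someI)
  then interpret rational_place_parameter emb F P s
    using residue_exists by unfold_locales
  show ?thesis
    unfolding residue_def Let_def s_def[symmetric]
    using residue_simple_pole[OF assms(1,2) local_parameter_x assms(3)] .
qed

end

subsection \<open>Sums over the evaluation points\<close>

text \<open>Each \<open>Q u\<close> is monic of degree \<open>card T - 1\<close>, so the sum is the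
  coefficient of that degree in \<open>L\<close>; the bound on \<open>degree p\<close> makes
  \<open>L\<close> equal to \<open>p\<close> and this coefficient 0.\<close>

lemma lagrange_sum_eq_0:
  fixes p :: "'a::field poly"
  assumes "finite T" "degree p + 2 \<le> card T"
  shows "(\<Sum>u\<in>T. inverse (\<Prod>v\<in>T - {u}. u - v) * poly p u) = 0"
proof -
  define c where "c u = inverse (\<Prod>v\<in>T - {u}. u - v) * poly p u" for u
  define Q where "Q u = (\<Prod>v\<in>T - {u}. [:- v, 1:])" for u
  define L where "L = (\<Sum>u\<in>T. smult (c u) (Q u))"
  have degree_Q: "degree (Q u) = card T - 1" and coeff_Q: "coeff (Q u) (card T - 1) = 1"
    if "u \<in> T" for u
  proof -
    show *: "degree (Q u) = card T - 1"
      using that \<open>finite T\<close> unfolding Q_def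
      by (subst degree_prod_eq_sum_degree) auto
    have "lead_coeff (Q u) = 1" unfolding Q_def by (simp add: lead_coeff_prod)
    thus "coeff (Q u) (card T - 1) = 1" using * by simp
  qed
  have "poly L v = poly p v" if "v \<in> T" for v
  proof -
    have "poly (Q u) v = 0" if "u \<in> T - {v}" for u
      using that \<open>v \<in> T\<close> \<open>finite T\<close> by (auto simp: Q_def poly_prod intro!: prod_zero)
    hence "poly L v = c v * poly (Q v) v"
      using \<open>v \<in> T\<close> \<open>finite T\<close> by (simp add: L_def poly_sum sum.remove)
    moreover have "poly (Q v) v = (\<Prod>w\<in>T - {v}. v - w)" by (simp add: Q_def poly_prod)
    moreover have "(\<Prod>w\<in>T - {v}. v - w) \<noteq> 0" using \<open>finite T\<close> by auto
    ultimately show ?thesis by (simp add: c_def)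
  qed
  moreover have "degree L < card T"
  proof -
    have "degree L \<le> card T - 1"
      unfolding L_def using degree_Q \<open>finite T\<close>
      by (intro degree_sum_le) (auto intro: order_trans[OF degree_smult_le])
    thus ?thesis using assms by simp
  qed
  ultimately have "L = p"
    using assms by (intro poly_eqI_degree[of T]) auto
  have "(\<Sum>u\<in>T. c u) = coeff L (card T - 1)"
    using coeff_Q by (auto simp: L_def coeff_sum intro!: sum.cong)
  also have "\<dots> = 0" unfolding \<open>L = p\<close> using assms by (intro coeff_eq_0) simp
  finally show ?thesis by (simp add: c_def)
qed

text \<open>Negation permutes the nonzero elements, so their product does not change under (-1)^(q -
  1); for even q this exponent is odd and -1 = 1.\<close>

lemma two_eq_0_if_even_card:
  assumes "even (card (UNIV :: 'a::{field,finite} set))" shows "(2 :: 'a) = 0"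
proof -
  define U where "U = UNIV - {0 :: 'a}"
  have "(\<Prod>v\<in>U. v) = (\<Prod>v\<in>U. - v)"
    by (rule prod.reindex_bij_witness[of _ uminus uminus]) (auto simp: U_def)
  also have "\<dots> = (- 1) ^ card U * (\<Prod>v\<in>U. v)"
    using prod.distrib[of "\<lambda>_. - 1" "\<lambda>v. v" U] by simp
  finally have "(- 1) ^ card U = (1 :: 'a)" by (simp add: U_def)
  moreover have "odd (card U)"
    using assms by (simp add: U_def card_Diff_singleton)
  ultimately have "- 1 = (1 :: 'a)" by simp
  thus ?thesis by (metis add.right_inverse one_add_one)
qed

text \<open>By Vieta the roots are v and - e - v; as there are two of them, their difference 2 v + e
  is nonzero. This is how complete splitting supplies \<open>distinct_residues\<close>, also in
  characteristic 2.\<close>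

lemma quadratic_fiber:
  fixes e h v :: "'a::idom"
  assumes card: "card {v. v ^ 2 + e * v = h} = 2" and v: "v ^ 2 + e * v = h"
  shows "{v. v ^ 2 + e * v = h} = {v, - e - v}" and "v \<noteq> - e - v" and "2 * v + e \<noteq> 0"
proof -
  have subset: "{v. v ^ 2 + e * v = h} \<subseteq> {v, - e - v}"
  proof
    fix v' assume "v' \<in> {v. v ^ 2 + e * v = h}"
    moreover have "(v' - v) * (v' + e + v) = (v' ^ 2 + e * v') - (v ^ 2 + e * v)"
      by (simp add: algebra_simps power2_eq_square)
    ultimately have "(v' - v) * (v' + e + v) = 0" using v by simp
    hence "v' = v \<or> v' = - e - v" by (auto simp: eq_diff_eq eq_neg_iff_add_eq_0 add_ac)
    thus "v' \<in> {v, - e - v}" by simp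
  qed
  have "card {v. v ^ 2 + e * v = h} \<le> card {v, - e - v}"
    using subset by (intro card_mono) auto
  hence "card {v, - e - v} \<noteq> card {v}" using card by simp
  thus "v \<noteq> - e - v" by (metis insert_absorb2)
  moreover have "v - (- e - v) = 2 * v + e" by simp
  ultimately show "2 * v + e \<noteq> 0" by (metis eq_iff_diff_eq_0)
  show "{v. v ^ 2 + e * v = h} = {v, - e - v}"
    using \<open>v \<noteq> - e - v\<close> subset card by (intro card_subset_eq) auto
qed

text \<open>The common shape of the three curves above \<open>T\<close>: e is 0 for the first type
  and 1 for the others. \<open>h\<close> is a function and not a polynomial because of the fraction
  in the third type.\<close>

locale split_points =
  fixes emb :: "'a::{field,finite} \<Rightarrow> 'f::field" and x y :: 'f and F :: "'f set"
    and C :: "('a \<times> 'a) set" and T :: "'a set" and n :: nat and \<alpha> \<beta> :: "nat \<Rightarrow> 'a"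
    and P :: "nat \<Rightarrow> 'f set" and e h :: "'a \<Rightarrow> 'a"
  assumes points: "evaluation_points emb x y F C T n \<alpha> \<beta> P"
    and point_iff: "u \<in> T \<Longrightarrow> (u, v) \<in> C \<longleftrightarrow> v ^ 2 + e u * v = h u"
begin

lemma fiber_card: "u \<in> T \<Longrightarrow> card {v. v ^ 2 + e u * v = h u} = 2"
  using points by (simp add: evaluation_points_def point_iff)

lemma points_bij: "bij_betw (\<lambda>j. (\<alpha> j, \<beta> j)) {1..n} (SIGMA u:T. {v. v ^ 2 + e u * v = h u})"
proof -
  have "{(u, v) \<in> C. u \<in> T} = (SIGMA u:T. {v. v ^ 2 + e u * v = h u})"
    using point_iff by auto
  thus ?thesis using points by (simp add: evaluation_points_def)
qed

lemma sum_over_points: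
  "(\<Sum>j=1..n. H (\<alpha> j) (\<beta> j)) = (\<Sum>u\<in>T. \<Sum>v | v ^ 2 + e u * v = h u. H u v)"
  using sum.reindex_bij_betw[OF points_bij, of "\<lambda>(u, v). H u v"]
  by (simp add: sum.Sigma)

lemma card_points: "n = 2 * card T"
  using bij_betw_same_card[OF points_bij] fiber_card by (simp add: card_SigmaI)

lemma point_in_fiber:
  assumes "j \<in> {1..n}"
  shows "\<alpha> j \<in> T" and "\<beta> j ^ 2 + e (\<alpha> j) * \<beta> j = h (\<alpha> j)" and "2 * \<beta> j + e (\<alpha> j) \<noteq> 0"
proof -
  have *: "(\<alpha> j, \<beta> j) \<in> (SIGMA u:T. {v. v ^ 2 + e u * v = h u})"
    using bij_betwE[OF points_bij] assms by blast
  thus "\<alpha> j \<in> T" "\<beta> j ^ 2 + e (\<alpha> j) * \<beta> j = h (\<alpha> j)" by auto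
  thus "2 * \<beta> j + e (\<alpha> j) \<noteq> 0" using quadratic_fiber(3) fiber_card by blast
qed

lemma point_place:
  assumes "j \<in> {1..n}"
  shows "place emb F (P j)" and "x - emb (\<alpha> j) \<in> P j" and "y - emb (\<beta> j) \<in> P j"
  using points assms by (auto simp: evaluation_points_def)

text \<open>The residues depend only on the first coordinate, so each fibre contributes its weight
  times the trace of \<open>H\<close>.\<close>

lemma weighted_sum_eq_0:
  assumes \<gamma>: "\<And>j. j \<in> {1..n} \<Longrightarrow> \<gamma> j = inverse (\<Prod>u\<in>T - {\<alpha> j}. \<alpha> j - u)"
    and trace: "\<And>u v. u \<in> T \<Longrightarrow> H u v + H u (- e u - v) = poly p u"
    and degree: "degree p + 2 \<le> card T"
  shows "(\<Sum>j=1..n. \<gamma> j * H (\<alpha> j) (\<beta> j)) = 0"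
proof -
  have "(\<Sum>j=1..n. \<gamma> j * H (\<alpha> j) (\<beta> j)) =
      (\<Sum>j=1..n. inverse (\<Prod>u\<in>T - {\<alpha> j}. \<alpha> j - u) * H (\<alpha> j) (\<beta> j))"
    using \<gamma> by simp
  also have "\<dots> = (\<Sum>u\<in>T. inverse (\<Prod>w\<in>T - {u}. u - w) * (\<Sum>v | v ^ 2 + e u * v = h u. H u v))"
    unfolding sum_over_points[of "\<lambda>u v. inverse (\<Prod>w\<in>T - {u}. u - w) * H u v"]
    by (simp add: sum_distrib_left)
  also have "\<dots> = (\<Sum>u\<in>T. inverse (\<Prod>w\<in>T - {u}. u - w) * poly p u)"
  proof (intro sum.cong refl arg_cong2[where f = "(*)"])
    fix u assume u: "u \<in> T"
    hence "{v. v ^ 2 + e u * v = h u} \<noteq> {}" using fiber_card by fastforce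
    then obtain v where v: "v ^ 2 + e u * v = h u" by auto
    note fiber = quadratic_fiber[OF fiber_card[OF u] v]
    show "(\<Sum>v | v ^ 2 + e u * v = h u. H u v) = poly p u"
      using trace[OF u] fiber(2) by (simp add: fiber(1))
  qed
  also have "\<dots> = 0" using degree by (intro lagrange_sum_eq_0) auto
  finally show ?thesis .
qed

end

section \<open>Residues on the three curves\<close>

lemma function_field_placeI:
  assumes "generated_function_field emb x y F" "place emb F P"
  shows "function_field_place emb F P"
  using assms is_subfield_hull
  by unfold_locales (auto simp: generated_function_field_def)

text \<open>Serves the first type with e = 0 and the second with e = 1; here w = y and D =
  1.\<close>

lemma residue_artin_schreier_or_kummer:
  fixes emb :: "'a::{field,finite} \<Rightarrow> 'f::field"
  assumes F: "generated_function_field emb x y F" and P: "place emb F P"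
    and curve: "y ^ 2 + emb e * y = poly (map_poly emb f) x"
    and x: "x - emb \<alpha> \<in> P" and y: "y - emb \<beta> \<in> P" and "2 * \<beta> + e \<noteq> 0"
    and T: "\<alpha> \<in> T" "t = (\<Prod>u\<in>T. x - emb u)"
  shows "residue emb F P (1 / t) x = inverse (\<Prod>u\<in>T - {\<alpha>}. \<alpha> - u)"
proof -
  interpret function_field_place emb F P using F P by (rule function_field_placeI)
  interpret quadratic_place emb F P x y y 1 "[:e:]" f \<alpha> \<beta>
    using assms by unfold_locales (auto simp: generated_function_field_def poly_at_def map_poly_pCons)
  show ?thesis using T by (intro residue_eq) auto
qed

text \<open>Multiplying the curve equation by (a x + b)^2 gives a monic quadratic equation with
  polynomial coefficients for w = (a x + b) y.\<close>

lemma residue_third_type: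
  fixes emb :: "'a::{field,finite} \<Rightarrow> 'f::field"
  assumes third: "third_type emb x y F a b" and P: "place emb F P"
    and x: "x - emb \<alpha> \<in> P" and y: "y - emb \<beta> \<in> P"
    and \<alpha>: "a * \<alpha> + b \<noteq> 0" and two: "2 * \<beta> + 1 \<noteq> 0"
    and T: "\<alpha> \<in> T" "t = (\<Prod>u\<in>T. x - emb u)"
  shows "residue emb F P (1 / t) x = inverse (\<Prod>u\<in>T - {\<alpha>}. \<alpha> - u)"
proof -
  have F: "generated_function_field emb x y F" and "a \<noteq> 0"
    and curve: "y ^ 2 + y = x + 1 / (emb a * x + emb b)"
    using third by (auto simp: third_type_def)
  interpret function_field_place emb F P using F P by (rule function_field_placeI)
  let ?D = "[:b, a:]"
  have D: "poly_at x ?D = emb a * x + emb b" by simp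
  have "poly_at x ?D \<noteq> 0"
    using F \<open>a \<noteq> 0\<close>
    by (auto simp: generated_function_field_def transcendental_over_def poly_at_def simp del: D)
  hence "(poly_at x ?D * y) ^ 2 + poly_at x ?D * (poly_at x ?D * y) =
      (poly_at x ?D) ^ 2 * x + poly_at x ?D"
    using arg_cong[OF curve[folded D], of "\<lambda>z. poly_at x ?D ^ 2 * z"]
    by (simp add: power2_eq_square ring_distribs mult_ac del: poly_at_pCons)
  hence quadratic: "(poly_at x ?D * y) ^ 2 + poly_at x ?D * (poly_at x ?D * y) =
      poly_at x (?D * ?D * [:0, 1:] + ?D)"
    by (simp only: poly_at_add poly_at_mult power2_eq_square) simp
  have "x \<in> R" "y \<in> R"
    using R_add[OF P_subset_R[OF x] R_emb[of \<alpha>]] R_add[OF P_subset_R[OF y] R_emb[of \<beta>]] by auto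
  hence "poly_at x ?D * (y - emb \<beta>) + emb (a * \<beta>) * (x - emb \<alpha>) \<in> P"
    using x y unfolding D by (intro P_add P_mult' R_add R_mult R_emb)
  hence residue: "poly_at x ?D * y - emb ((a * \<alpha> + b) * \<beta>) \<in> P"
    by (simp add: algebra_simps)
  \<comment> \<open>The residues of w and its conjugate differ by the unit factor times the
    difference of the two y-values.\<close>
  have "2 * ((a * \<alpha> + b) * \<beta>) + poly ?D \<alpha> = (a * \<alpha> + b) * (2 * \<beta> + 1)"
    by (simp add: algebra_simps)
  hence distinct: "2 * ((a * \<alpha> + b) * \<beta>) + poly ?D \<alpha> \<noteq> 0" using \<alpha> two by simp
  interpret quadratic_place emb F P x y "poly_at x ?D * y" ?D ?D "?D * ?D * [:0, 1:] + ?D"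
    \<alpha> "(a * \<alpha> + b) * \<beta>"
    using F \<open>a \<noteq> 0\<close> x residue quadratic distinct
    by unfold_locales (simp_all only: generated_function_field_def, simp_all)
  show ?thesis using T by (intro residue_eq) auto
qed

theorem mainTheorem2:
  fixes emb :: "'a::{field,finite} \<Rightarrow> 'f::field" and x y :: 'f and F :: "'f set"
    and T :: "'a set" and k n :: nat
    and \<alpha> \<beta> \<gamma> :: "nat \<Rightarrow> 'a" and P :: "nat \<Rightarrow> 'f set" and t :: 'f
  assumes "3 \<le> k" and "k < n"
    and t: "t = (\<Prod>u\<in>T. x - emb u)"
    and \<gamma>: "\<And>j. j \<in> {1..n} \<Longrightarrow> \<gamma> j = residue emb F (P j) (1 / t) x"
  shows
   "(\<forall>f. first_type emb x y F f \<and>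
         evaluation_points emb x y F (first_points f) T n \<alpha> \<beta> P \<longrightarrow>
       (\<forall>i::nat. int i \<le> int k div 2 + (int n - int k) div 2 \<longrightarrow>
          (\<Sum>j=1..n. \<gamma> j * \<alpha> j ^ i / \<beta> j) = 0) \<and>
       (\<forall>i::nat. int i \<le> int n div 2 - 2 \<longrightarrow>
          (\<Sum>j=1..n. \<gamma> j * \<alpha> j ^ i) = 0) \<and>
       (\<forall>i::nat. int i \<le> (int k - 3) div 2 + (int n - int k - 3) div 2 \<longrightarrow>
          (\<Sum>j=1..n. \<gamma> j * \<alpha> j ^ i * \<beta> j) = 0))
    \<and>
    (\<forall>f. second_type emb x y F f \<and>
         evaluation_points emb x y F (second_points f) T n \<alpha> \<beta> P \<longrightarrow>
       (\<forall>i::nat. int i \<le> int k div 2 + (int n - int k) div 2 \<longrightarrow>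
          (\<Sum>j=1..n. \<gamma> j * \<alpha> j ^ i) = 0) \<and>
       (\<forall>i::nat. int i \<le> int n div 2 - 2 \<longrightarrow>
          (\<Sum>j=1..n. \<gamma> j * \<alpha> j ^ i * \<beta> j) = 0) \<and>
       (\<forall>i::nat. int i \<le> (int k - 3) div 2 + (int n - int k - 3) div 2 \<longrightarrow>
          (\<Sum>j=1..n. \<gamma> j * \<alpha> j ^ i * \<beta> j ^ 2) = 0))
    \<and>
    (\<forall>a b. third_type emb x y F a b \<and>
         evaluation_points emb x y F (third_points a b) T n \<alpha> \<beta> P \<longrightarrow>
       (\<forall>i::nat. int i \<le> int k div 2 + (int n - int k) div 2 \<longrightarrow>
          (\<Sum>j=1..n. \<gamma> j * \<alpha> j ^ i / (a * \<alpha> j + b)) = 0) \<and>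
       (\<forall>i::nat. int i \<le> int n div 2 - 2 \<longrightarrow>
          (\<Sum>j=1..n. \<gamma> j * \<alpha> j ^ i * \<beta> j) = 0) \<and>
       (\<forall>i::nat. int i \<le> (int k - 3) div 2 + (int n - int k - 3) div 2 \<longrightarrow>
          (\<Sum>j=1..n. \<gamma> j * \<alpha> j ^ i * (a * \<alpha> j + b) * \<beta> j ^ 2) = 0))"
proof (intro conjI allI impI; elim conjE)
  fix f assume type: "first_type emb x y F f"
    and points: "evaluation_points emb x y F (first_points f) T n \<alpha> \<beta> P"
  interpret split_points emb x y F "first_points f" T n \<alpha> \<beta> P "\<lambda>_. 0" "poly f"
    using points by unfold_locales (auto simp: first_points_def)
  have emb0: "emb 0 = 0"
    using type constant_embedding.emb_0
    by (auto simp: first_type_def generated_function_field_def constant_embedding_def)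
  have \<gamma>': "\<gamma> j = inverse (\<Prod>u\<in>T - {\<alpha> j}. \<alpha> j - u)" if "j \<in> {1..n}" for j
    unfolding \<gamma>[OF that]
    by (rule residue_artin_schreier_or_kummer[where y = y and e = 0 and f = f and \<beta> = "\<beta> j"])
      (use type point_place[OF that] point_in_fiber[OF that] t emb0 in \<open>auto simp: first_type_def\<close>)
  note vanish = weighted_sum_eq_0[OF \<gamma>']
  \<comment> \<open>From n = 2 card T and n > 3. It is the degree condition for a zero trace, since
    the zero polynomial has degree 0.\<close>
  have card_T: "card T \<ge> 2" using card_points \<open>3 \<le> k\<close> \<open>k < n\<close> by simp
  fix i :: nat
  \<comment> \<open>Conjugation is v to -v, under which 1 / v and v are odd, so the traces vanish;
    division by 0 gives 0, so this also holds at v = 0.\<close>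
  show "(\<Sum>j=1..n. \<gamma> j * \<alpha> j ^ i / \<beta> j) = 0"
    using vanish[of "\<lambda>u v. u ^ i / v" 0] card_T by simp
  show "(\<Sum>j=1..n. \<gamma> j * \<alpha> j ^ i * \<beta> j) = 0"
    using vanish[of "\<lambda>u v. u ^ i * v" 0] card_T by (simp add: mult.assoc)
  assume "int i \<le> int n div 2 - 2"
  \<comment> \<open>A function of x alone is counted twice in each fibre, hence the coefficient
    2.\<close>
  hence "degree (monom (2 :: 'a) i) + 2 \<le> card T"
    using degree_monom_le[of "2 :: 'a" i] card_points by linarith
  thus "(\<Sum>j=1..n. \<gamma> j * \<alpha> j ^ i) = 0"
    using vanish[of "\<lambda>u v. u ^ i" "monom 2 i"] by (simp add: poly_monom)
next
  fix f assume type: "second_type emb x y F f"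
    and points: "evaluation_points emb x y F (second_points f) T n \<alpha> \<beta> P"
  interpret split_points emb x y F "second_points f" T n \<alpha> \<beta> P "\<lambda>_. 1" "poly f"
    using points by unfold_locales (auto simp: second_points_def)
  have two: "(2 :: 'a) = 0"
    using type by (auto simp: second_type_def intro: two_eq_0_if_even_card)
  have \<gamma>': "\<gamma> j = inverse (\<Prod>u\<in>T - {\<alpha> j}. \<alpha> j - u)" if "j \<in> {1..n}" for j
    unfolding \<gamma>[OF that]
    by (rule residue_artin_schreier_or_kummer[where y = y and e = 1 and f = f and \<beta> = "\<beta> j"])
      (use type point_place[OF that] point_in_fiber[OF that] t in
        \<open>auto simp: second_type_def generated_function_field_def field_embedding_def\<close>)
  note vanish = weighted_sum_eq_0[OF \<gamma>']
  have card_T: "card T \<ge> 2" using card_points \<open>3 \<le> k\<close> \<open>k < n\<close> by simp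
  fix i :: nat
  \<comment> \<open>In characteristic 2 a function of x alone has trace 0.\<close>
  show "(\<Sum>j=1..n. \<gamma> j * \<alpha> j ^ i) = 0"
    using vanish[of "\<lambda>u v. u ^ i" 0] card_T by (simp add: two flip: mult_2)
  \<comment> \<open>The two y-values sum to -1, which gives the trace polynomial
    \<open>- monom 1 i\<close>.\<close>
  show "(\<Sum>j=1..n. \<gamma> j * \<alpha> j ^ i * \<beta> j) = 0" if "int i \<le> int n div 2 - 2"
    using vanish[of "\<lambda>u v. u ^ i * v" "- monom 1 i"] that card_points
    by (simp add: poly_monom degree_monom_eq algebra_simps)
  assume "int i \<le> (int k - 3) div 2 + (int n - int k - 3) div 2"
  hence "i + 2 \<le> card T" using card_points by linarith
  \<comment> \<open>In characteristic 2 this trace of the square is 1 for every v.\<close>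
  moreover have "v ^ 2 + (- 1 - v) ^ 2 = 2 * (v ^ 2 + v) + 1" for v :: 'a
    by (simp add: power2_eq_square algebra_simps)
  hence "u ^ i * v ^ 2 + u ^ i * (- 1 - v) ^ 2 = u ^ i" for u v :: 'a
    unfolding distrib_left[symmetric] by (simp add: two)
  ultimately show "(\<Sum>j=1..n. \<gamma> j * \<alpha> j ^ i * \<beta> j ^ 2) = 0"
    using vanish[of "\<lambda>u v. u ^ i * v ^ 2" "monom 1 i"]
    by (simp add: poly_monom degree_monom_eq mult.assoc)
next
  fix a b assume type: "third_type emb x y F a b"
    and points: "evaluation_points emb x y F (third_points a b) T n \<alpha> \<beta> P"
  \<comment> \<open>A zero of a u + b has an empty fibre in \<open>third_points\<close>, so it
    cannot split.\<close>
  have unit: "a * u + b \<noteq> 0" if "u \<in> T" for u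
  proof
    assume "a * u + b = 0"
    hence "{v. (u, v) \<in> third_points a b} = {}" by (simp add: third_points_def)
    moreover have "card {v. (u, v) \<in> third_points a b} = 2"
      using points that unfolding evaluation_points_def by blast
    ultimately show False by simp
  qed
  interpret split_points emb x y F "third_points a b" T n \<alpha> \<beta> P "\<lambda>_. 1"
    "\<lambda>u. u + 1 / (a * u + b)"
    using points unit by unfold_locales (auto simp: third_points_def)
  have two: "(2 :: 'a) = 0"
    using type by (auto simp: third_type_def intro: two_eq_0_if_even_card)
  have \<gamma>': "\<gamma> j = inverse (\<Prod>u\<in>T - {\<alpha> j}. \<alpha> j - u)" if "j \<in> {1..n}" for j
    unfolding \<gamma>[OF that]
    using type point_place[OF that] unit point_in_fiber[OF that] t
    by (intro residue_third_type) auto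
  note vanish = weighted_sum_eq_0[OF \<gamma>']
  have card_T: "card T \<ge> 2" using card_points \<open>3 \<le> k\<close> \<open>k < n\<close> by simp
  fix i :: nat
  show "(\<Sum>j=1..n. \<gamma> j * \<alpha> j ^ i / (a * \<alpha> j + b)) = 0"
    using vanish[of "\<lambda>u v. u ^ i / (a * u + b)" 0] card_T by (simp add: two flip: mult_2)
  show "(\<Sum>j=1..n. \<gamma> j * \<alpha> j ^ i * \<beta> j) = 0" if "int i \<le> int n div 2 - 2"
    using vanish[of "\<lambda>u v. u ^ i * v" "- monom 1 i"] that card_points
    by (simp add: poly_monom degree_monom_eq algebra_simps)
  assume "int i \<le> (int k - 3) div 2 + (int n - int k - 3) div 2"
  \<comment> \<open>The two floors add up to at most n / 2 - 3; the extra 1 compared with the second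
    type pays for the linear factor a x + b in the trace.\<close>
  hence "i + 3 \<le> card T" using card_points by linarith
  moreover have "degree ([:b, a:] * monom 1 i) \<le> i + 1"
    using degree_mult_le[of "[:b, a:]" "monom 1 i"]
    by (auto simp: degree_monom_eq split: if_splits)
  moreover have "v ^ 2 + (- 1 - v) ^ 2 = 2 * (v ^ 2 + v) + 1" for v :: 'a
    by (simp add: power2_eq_square algebra_simps)
  hence "u ^ i * (a * u + b) * v ^ 2 + u ^ i * (a * u + b) * (- 1 - v) ^ 2 =
      poly ([:b, a:] * monom 1 i) u" for u v :: 'a
    unfolding distrib_left[symmetric] by (simp add: two poly_monom algebra_simps)
  ultimately show "(\<Sum>j=1..n. \<gamma> j * \<alpha> j ^ i * (a * \<alpha> j + b) * \<beta> j ^ 2) = 0"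
    using vanish[of "\<lambda>u v. u ^ i * (a * u + b) * v ^ 2" "[:b, a:] * monom 1 i"]
    by (simp add: mult.assoc)
qed

end
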